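(* Let $\alpha,\beta>-1$ and $c\in(0,1)$ be fixed, and let $x<-1/2$ be a fixed real number. As $n\to\infty$ with $N$ such that $n/N=c$, $$Q_n(x;\alpha,\beta,N-1)\sim\frac{\Gamma(\alpha+1)\,\Gamma(N-n)}{\Gamma(N)\,\Gamma(-x)\,e^n\,n^{2x+2\alpha+2}}\,(1+c)^{n+N+\alpha+\beta+1/2}\,N^{x+n+\alpha+1},$$ i.e. the ratio of the two sides tends to $1$.
   Context: The Hahn polynomials are, for $\alpha,\beta>-1$, $$Q_n(x;\alpha,\beta,N)=\sum_{k=0}^n\frac{(-n)_k(-x)_k(n+\alpha+\beta+1)_k}{(-N)_k(\alpha+1)_k\,k!},$$ where $(\cdot)_k$ is the Pochhammer symbol. *)

theory Defs
  imports "HOL-Analysis.Analysis" "HOL-Library.Landau_Symbols"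
begin

(* The parameter N is real: integer values are the classical discrete case, and the formula is
   meaningful whenever N is not one of 0, ..., n - 1, so that no denominator vanishes. *)
definition Hahn :: "nat \<Rightarrow> real \<Rightarrow> real \<Rightarrow> real \<Rightarrow> real \<Rightarrow> real" where
  "Hahn n x \<alpha> \<beta> N =
     (\<Sum>k=0..n. (pochhammer (- real n) k * pochhammer (- x) k * pochhammer (real n + \<alpha> + \<beta> + 1) k)
              / (pochhammer (- N) k * pochhammer (\<alpha> + 1) k * fact k))"

end

theory Submission
  imports Defs "HOL-Real_Asymp.Real_Asymp"
begin

text \<open>
  With $a = \alpha + \beta + 1$, the $k$-th term of the sum for $Q_n(x;\alpha,\beta,N-1)$ is $w_k g_k$, where
  $w_k = (-n)_k (n+a)_k / ((1-N)_k\, k!)$ does not involve $x$ and $g_k = (-x)_k / (\alpha+1)_k$ does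
  not involve $n$. All these numbers are positive when $n < N$.

  The weights $w_k$ have a sharp peak. The quotient $w_{k+1}/w_k$ exceeds 1 by a fixed amount as
  long as $k \le (c-\delta) n$, and is below 1 by a fixed amount once $k \ge (c+\delta) n$, because its
  numerator minus its denominator is $n^2 - Nk + O(n) = N (cn - k) + O(n)$
  (\<open>hahn_weight_ratio\<close>). So the part of the total weight away from $k = cn$ is exponentially
  small (\<open>exp_tail_of_local_ratio\<close>). The factor $g_k$ grows or decays only like a power,
  $g_k \sim \Gamma(\alpha+1)/\Gamma(-x) \cdot k^p$ with $p = -x-\alpha-1$, and so can be replaced by its value at
  the peak (\<open>weighted_sum_asymp_equiv\<close>). This gives
  \[ Q_n(x;\alpha,\beta,N-1) \sim \frac{\Gamma(\alpha+1)}{\Gamma(-x)} (cn)^p \sum_k w_k . \]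

  The total weight is a terminating hypergeometric series ${}_2F_1(-n, n+a; 1-N; 1)$, which the
  Chu--Vandermonde identity evaluates to $(N+a)_n\, \Gamma(N-n) / \Gamma(N)$ (\<open>sum_hahn_weight\<close>).
  Stirling's formula turns $(N+a)_n$ into $(1+c)^{n+N+a-1/2} N^n e^{-n}$
  (\<open>pochhammer_asymp_equiv\<close>), and $(cn)^p = n^{2p} N^{-p}$ brings the result into the stated form.
\<close>

section \<open>Sums against weights with a sharp peak\<close>

text \<open>
  If the weights grow geometrically up to a neighbourhood of $cn$ and decay geometrically beyond
  it, then from any $k$ at distance $\delta n$ from the peak one can take about $\delta n/2$ steps towards
  it, gaining a factor $1+\eta$ each time and arriving at a weight bounded by the total.
\<close>
lemma exp_tail_of_local_ratio:
  fixes w :: "nat \<Rightarrow> nat \<Rightarrow> real" and c :: real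
  assumes nonneg: "\<And>n k. k \<le> n \<Longrightarrow> w n k \<ge> 0"
  assumes ratio: "\<And>\<delta>. \<delta> > 0 \<Longrightarrow> \<exists>\<eta>>0. \<forall>\<^sub>F n in sequentially. \<forall>k<n.
      (real k \<le> (c - \<delta>) * real n \<longrightarrow> (1 + \<eta>) * w n k \<le> w n (Suc k)) \<and>
      (real k \<ge> (c + \<delta>) * real n \<longrightarrow> (1 + \<eta>) * w n (Suc k) \<le> w n k)"
  assumes "\<delta> > 0" and c: "0 < c" "c < 1"
  shows "\<exists>\<kappa>>0. \<forall>\<^sub>F n in sequentially. \<forall>k\<le>n. \<bar>real k - c * real n\<bar> \<ge> \<delta> * real n \<longrightarrow>
           w n k \<le> exp (- \<kappa> * real n) * (\<Sum>i\<le>n. w n i)"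
proof -
  define \<epsilon> where "\<epsilon> = \<delta> / 2"
  have \<epsilon>: "\<epsilon> > 0" using assms by (simp add: \<epsilon>_def)
  obtain \<eta> where \<eta>: "\<eta> > 0" and ev: "\<forall>\<^sub>F n in sequentially. \<forall>k<n.
      (real k \<le> (c - \<epsilon>) * real n \<longrightarrow> (1 + \<eta>) * w n k \<le> w n (Suc k)) \<and>
      (real k \<ge> (c + \<epsilon>) * real n \<longrightarrow> (1 + \<eta>) * w n (Suc k) \<le> w n k)"
    using ratio[OF \<epsilon>] by blast
  define \<kappa> where "\<kappa> = \<epsilon> * ln (1 + \<eta>) / 2"
  have l: "ln (1 + \<eta>) > 0" using \<eta> by simp
  have \<kappa>: "\<kappa> > 0" using \<epsilon> l by (simp add: \<kappa>_def)
  have big: "\<forall>\<^sub>F n in sequentially. \<kappa> * real n \<le> (\<epsilon> * real n - 1) * ln (1 + \<eta>)"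
    unfolding \<kappa>_def using \<epsilon> l by real_asymp
  have "\<forall>\<^sub>F n in sequentially. \<forall>k\<le>n. \<bar>real k - c * real n\<bar> \<ge> \<delta> * real n \<longrightarrow>
           w n k \<le> exp (- \<kappa> * real n) * (\<Sum>i\<le>n. w n i)"
    using ev big
  proof eventually_elim
    case (elim n)
    define d where "d = nat \<lfloor>\<epsilon> * real n\<rfloor>"
    have d_le: "real d \<le> \<epsilon> * real n" unfolding d_def using \<epsilon> by simp
    have d_ge: "real d \<ge> \<epsilon> * real n - 1" unfolding d_def using \<epsilon> by linarith
    have "exp (\<kappa> * real n) \<le> exp (real d * ln (1 + \<eta>))"
    proof -
      have "(\<epsilon> * real n - 1) * ln (1 + \<eta>) \<le> real d * ln (1 + \<eta>)"
        using d_ge l by (intro mult_right_mono) auto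
      thus ?thesis using elim(2) by simp
    qed
    also have "\<dots> = (1 + \<eta>) ^ d" using \<eta> by (simp add: exp_of_nat_mult)
    finally have pw: "exp (\<kappa> * real n) \<le> (1 + \<eta>) ^ d" .
    show ?case
    proof (intro allI impI)
      fix k assume k: "k \<le> n" "\<delta> * real n \<le> \<bar>real k - c * real n\<bar>"
      have "\<exists>m\<le>n. (1 + \<eta>) ^ d * w n k \<le> w n m"
      proof (cases "real k \<le> c * real n")
        case True
        hence kle: "real k \<le> (c - 2 * \<epsilon>) * real n" using k by (simp add: \<epsilon>_def algebra_simps)
        have below: "real (k + i) \<le> (c - \<epsilon>) * real n" if "i \<le> d" for i
          using kle d_le that by (simp add: algebra_simps)
        have "(c - \<epsilon>) * real n \<le> 1 * real n" using c \<epsilon> by (intro mult_right_mono) auto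
        hence kd: "k + d \<le> n" using below[of d] by linarith
        have "(1 + \<eta>) ^ i * w n k \<le> w n (k + i)" if "i \<le> d" for i
          using that
        proof (induction i)
          case (Suc i)
          have "(1 + \<eta>) ^ Suc i * w n k = (1 + \<eta>) * ((1 + \<eta>) ^ i * w n k)" by simp
          also have "\<dots> \<le> (1 + \<eta>) * w n (k + i)"
            using Suc \<eta> by (intro mult_left_mono) auto
          also have "\<dots> \<le> w n (Suc (k + i))"
            using elim(1) below[of i] Suc.prems kd by auto
          finally show ?case by simp
        qed simp
        thus ?thesis using kd by blast
      next
        case False
        hence kge: "real k \<ge> (c + 2 * \<epsilon>) * real n" using k by (simp add: \<epsilon>_def algebra_simps)
        have "(c + \<epsilon>) * real n \<ge> 0" using c \<epsilon> by simp
        hence dk: "d \<le> k" using kge d_le by (simp add: algebra_simps)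
        have above: "real (k - i) \<ge> (c + \<epsilon>) * real n" if "i \<le> d" for i
          using kge d_le that dk by (simp add: algebra_simps of_nat_diff)
        have "(1 + \<eta>) ^ i * w n k \<le> w n (k - i)" if "i \<le> d" for i
          using that
        proof (induction i)
          case (Suc i)
          have "(1 + \<eta>) ^ Suc i * w n k = (1 + \<eta>) * ((1 + \<eta>) ^ i * w n k)" by simp
          also have "\<dots> \<le> (1 + \<eta>) * w n (Suc (k - Suc i))"
            using Suc \<eta> dk by (intro mult_left_mono) (auto simp: Suc_diff_Suc)
          also have "\<dots> \<le> w n (k - Suc i)"
            using elim(1) above[of "Suc i"] Suc.prems k dk by auto
          finally show ?case .
        qed simp
        thus ?thesis using k by (meson diff_le_self dual_order.trans order_refl)
      qed
      then obtain m where m: "m \<le> n" "(1 + \<eta>) ^ d * w n k \<le> w n m" by blast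
      have "exp (\<kappa> * real n) * w n k \<le> (1 + \<eta>) ^ d * w n k"
        using pw nonneg k by (intro mult_right_mono) auto
      also have "\<dots> \<le> w n m" by fact
      also have "\<dots> \<le> (\<Sum>i\<le>n. w n i)"
        using m nonneg by (intro member_le_sum) auto
      finally show "w n k \<le> exp (- \<kappa> * real n) * (\<Sum>i\<le>n. w n i)"
        by (simp add: exp_minus field_simps)
    qed
  qed
  thus ?thesis using \<kappa> by blast
qed

text \<open>
  Laplace's method for sums. Near the peak, $g_k / (L (cn)^p)$ is uniformly close to 1. Away from it
  this quotient is at most polynomial in $n$, also for $p < 0$, where small $k$ make it large, and
  so exponentially small tails absorb it. For that reason a bound on the variance of the weights
  would not be enough.
\<close>
lemma weighted_sum_asymp_equiv:
  fixes w :: "nat \<Rightarrow> nat \<Rightarrow> real" and g :: "nat \<Rightarrow> real" and c L p :: real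
  assumes nonneg: "\<And>n k. k \<le> n \<Longrightarrow> w n k \<ge> 0"
    and pos: "\<forall>\<^sub>F n in sequentially. (\<Sum>k\<le>n. w n k) > 0"
    and tail: "\<And>\<delta>. \<delta> > 0 \<Longrightarrow> \<exists>\<kappa>>0. \<forall>\<^sub>F n in sequentially. \<forall>k\<le>n.
          \<bar>real k - c * real n\<bar> \<ge> \<delta> * real n \<longrightarrow> w n k \<le> exp (- \<kappa> * real n) * (\<Sum>i\<le>n. w n i)"
    and g: "(\<lambda>k. g k / real k powr p) \<longlonglongrightarrow> L" and L: "L > 0" and c: "c > 0"
  shows "(\<lambda>n. \<Sum>k\<le>n. w n k * g k) \<sim>[sequentially] (\<lambda>n. L * (c * real n) powr p * (\<Sum>k\<le>n. w n k))"
proof (rule asymp_equivI')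
  define W where "W = (\<lambda>n. \<Sum>k\<le>n. w n k)"
  define h where "h = (\<lambda>n k. g k / (L * (c * real n) powr p))"
  obtain B where B: "B > 0" "\<And>k. \<bar>g k / real k powr p\<bar> \<le> B"
    using convergent_imp_Bseq[OF convergentI[OF g]] by (auto simp: Bseq_def)
  define P where "P = \<bar>p\<bar>"
  define C where "C = B + \<bar>g 0\<bar>"
  \<comment> \<open>The value at 0 needs its own constant, because \<open>g 0 / 0 powr p\<close> is 0 by convention.\<close>
  have gb: "\<bar>g k\<bar> \<le> C * real n powr P" if "k \<le> n" "n > 0" for n k
  proof (cases "k = 0")
    case True
    have "1 \<le> real n powr P" using that by (simp add: P_def ge_one_powr_ge_zero)
    hence "\<bar>g 0\<bar> * 1 \<le> C * real n powr P"
      unfolding C_def using B by (intro mult_mono) auto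
    thus ?thesis using True by simp
  next
    case False
    have "\<bar>g k\<bar> \<le> B * real k powr p" using B(2)[of k] False by (simp add: abs_mult field_simps)
    also have "real k powr p \<le> real k powr P" using False by (intro powr_mono) (auto simp: P_def)
    also have "real k powr P \<le> real n powr P" using that by (intro powr_mono2) (auto simp: P_def)
    also have "B * real n powr P \<le> C * real n powr P"
      by (intro mult_right_mono) (auto simp: C_def)
    finally show ?thesis using B by simp
  qed
  have Cpos: "C > 0" using B by (simp add: C_def)
  show "(\<lambda>n. (\<Sum>k\<le>n. w n k * g k) / (L * (c * real n) powr p * (\<Sum>k\<le>n. w n k))) \<longlonglongrightarrow> 1"
  proof (rule tendstoI)
    fix e :: real assume e: "e > 0"
    \<comment> \<open>Near the peak the quotient is \<open>u / L * v powr p\<close> with \<open>u = g k / k powr p\<close> close to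
        \<open>L\<close> and \<open>v = k / (c * n)\<close> close to 1, so uniformity follows from continuity at \<open>(L, 1)\<close>.\<close>
    have "isCont (\<lambda>z. fst z / L * snd z powr p) (L, 1)"
      using L by (intro continuous_intros) auto
    hence "\<exists>r>0. \<forall>z. dist z (L, 1) < r \<longrightarrow>
        dist (fst z / L * snd z powr p) (fst (L, 1) / L * snd (L, 1) powr p) < e / 2"
      unfolding continuous_at_eps_delta using e by (elim allE[of _ "e / 2"]) simp
    then obtain r where r: "r > 0" "\<And>u v. dist (u, v) (L, 1) < r \<Longrightarrow> \<bar>u / L * v powr p - 1\<bar> < e / 2"
      using L by (auto simp: dist_real_def)
    define \<rho> where "\<rho> = min (r / 2) (1 / 2)"
    have \<rho>: "\<rho> > 0" "\<rho> < 1" "\<rho> \<le> r / 2" using r by (auto simp: \<rho>_def)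
    have "\<forall>\<^sub>F k in sequentially. \<bar>g k / real k powr p - L\<bar> < r / 2"
      using tendstoD[OF g, of "r/2"] r by (simp add: dist_real_def)
    then obtain K where K: "\<And>k. k \<ge> K \<Longrightarrow> \<bar>g k / real k powr p - L\<bar> < r / 2"
      by (auto simp: eventually_sequentially)
    have "c * (1 - \<rho>) > 0" using c \<rho> by simp
    hence evK: "\<forall>\<^sub>F n in sequentially. c * (1 - \<rho>) * real n > real K + 1" by real_asymp
    obtain \<kappa> where \<kappa>: "\<kappa> > 0" and ev\<kappa>: "\<forall>\<^sub>F n in sequentially. \<forall>k\<le>n.
          \<bar>real k - c * real n\<bar> \<ge> \<rho> * c * real n \<longrightarrow> w n k \<le> exp (- \<kappa> * real n) * W n"
      using tail[of "\<rho> * c"] \<rho> c unfolding W_def by auto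
    have "(\<lambda>n. C / L * (real (Suc n) * exp (- \<kappa> * real n) * (real n powr P / (c * real n) powr p)) +
               real (Suc n) * exp (- \<kappa> * real n)) \<longlonglongrightarrow> C / L * 0 + 0"
      by (intro tendsto_intros) (use \<kappa> c in real_asymp)+
    also have "(\<lambda>n. C / L * (real (Suc n) * exp (- \<kappa> * real n) * (real n powr P / (c * real n) powr p)) +
               real (Suc n) * exp (- \<kappa> * real n)) =
        (\<lambda>n. real (Suc n) * (exp (- \<kappa> * real n) * (C * real n powr P / (L * (c * real n) powr p) + 1)))"
      by (intro ext, simp only: distrib_left mult_1_right times_divide_eq_right times_divide_eq_left
            divide_divide_eq_left mult_ac)
    finally have evt: "\<forall>\<^sub>F n in sequentially. real (Suc n) * (exp (- \<kappa> * real n) *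
        (C * real n powr P / (L * (c * real n) powr p) + 1)) < e / 2"
      using e by (intro order_tendstoD(2)[where y = 0]) simp_all
    show "\<forall>\<^sub>F n in sequentially. dist ((\<Sum>k\<le>n. w n k * g k) / (L * (c * real n) powr p * (\<Sum>k\<le>n. w n k))) 1 < e"
      using evK ev\<kappa> evt pos eventually_gt_at_top[of 0]
    proof eventually_elim
      case (elim n)
      have W: "W n > 0" using elim by (simp add: W_def)
      have cn: "c * real n > 0" using c elim by simp
      have "(c * real n) powr p > 0" using cn powr_gt_zero[of "c * real n" p] by linarith
      hence D: "L * (c * real n) powr p > 0" using L by simp
      define T where "T = C * real n powr P / (L * (c * real n) powr p) + 1"
      have T: "T \<ge> 0" using Cpos D by (simp add: T_def)
      have "(\<Sum>k\<le>n. w n k * g k) / (L * (c * real n) powr p * W n) - 1 = (\<Sum>k\<le>n. w n k * (h n k - 1)) / W n"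
      proof -
        have "(\<Sum>k\<le>n. w n k * (h n k - 1)) = (\<Sum>k\<le>n. w n k * g k) / (L * (c * real n) powr p) - W n"
          by (simp add: h_def W_def right_diff_distrib sum_subtractf sum_divide_distrib)
        thus ?thesis using W by (simp add: diff_divide_distrib)
      qed
      also have "\<bar>\<dots>\<bar> \<le> (\<Sum>k\<le>n. w n k * \<bar>h n k - 1\<bar>) / W n"
      proof -
        have "\<bar>\<Sum>k\<le>n. w n k * (h n k - 1)\<bar> \<le> (\<Sum>k\<le>n. \<bar>w n k * (h n k - 1)\<bar>)" by (rule sum_abs)
        also have "\<dots> = (\<Sum>k\<le>n. w n k * \<bar>h n k - 1\<bar>)" by (intro sum.cong) (auto simp: abs_mult nonneg)
        finally show ?thesis using W by (simp add: divide_right_mono)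
      qed
      also have "\<dots> \<le> (\<Sum>k\<le>n. w n k * (e / 2) + exp (- \<kappa> * real n) * W n * T) / W n"
      proof (intro divide_right_mono sum_mono)
        fix k assume "k \<in> {..n}"
        hence k: "k \<le> n" by simp
        show "w n k * \<bar>h n k - 1\<bar> \<le> w n k * (e / 2) + exp (- \<kappa> * real n) * W n * T"
        proof (cases "\<bar>real k - c * real n\<bar> \<ge> \<rho> * c * real n")
          case True
          have "\<bar>h n k - 1\<bar> \<le> \<bar>h n k\<bar> + 1" by simp
          also have "\<bar>h n k\<bar> = \<bar>g k\<bar> / (L * (c * real n) powr p)"
            using L by (simp add: h_def abs_mult)
          also have "\<dots> \<le> C * real n powr P / (L * (c * real n) powr p)"
            using gb[OF k] elim D by (intro divide_right_mono) auto
          finally have "\<bar>h n k - 1\<bar> \<le> T" by (simp add: T_def)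
          hence "w n k * \<bar>h n k - 1\<bar> \<le> (exp (- \<kappa> * real n) * W n) * T"
            using elim(2) k True nonneg[OF k] W by (intro mult_mono) auto
          moreover have "w n k * (e / 2) \<ge> 0" using nonneg[OF k] e by simp
          ultimately show ?thesis by simp
        next
          case False
          define v where "v = real k / (c * real n)"
          have v: "\<bar>v - 1\<bar> < \<rho>"
          proof -
            have "v - 1 = (real k - c * real n) / (c * real n)"
              unfolding v_def diff_divide_distrib using cn by (metis divide_self less_irrefl)
            hence "\<bar>v - 1\<bar> = \<bar>real k - c * real n\<bar> / (c * real n)" using cn by (simp only: abs_divide abs_of_pos)
            thus ?thesis using False cn by (simp only: pos_divide_less_eq not_le mult.assoc)
          qed
          have "real k > c * (1 - \<rho>) * real n" using False by (auto simp: algebra_simps abs_real_def split: if_splits)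
          hence kK: "real k > real K + 1" using elim(1) by linarith
          hence "k \<ge> K" by linarith
          have "dist (g k / real k powr p, v) (L, 1) \<le> \<bar>g k / real k powr p - L\<bar> + \<bar>v - 1\<bar>"
            unfolding dist_prod_def dist_real_def fst_conv snd_conv by (rule sqrt_sum_squares_le_sum) simp_all
          also have "\<dots> < r" using K[OF \<open>k \<ge> K\<close>] v \<rho> by linarith
          finally have "\<bar>g k / real k powr p / L * v powr p - 1\<bar> < e / 2" by (rule r)
          also have "g k / real k powr p / L * v powr p = h n k"
            using kK c \<open>n > 0\<close> by (simp add: v_def h_def powr_divide)
          finally have "w n k * \<bar>h n k - 1\<bar> \<le> w n k * (e / 2)"
            using nonneg[OF k] by (intro mult_left_mono) auto
          moreover have "exp (- \<kappa> * real n) * W n * T \<ge> 0" using W T by simp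
          ultimately show ?thesis by linarith
        qed
      qed (use W in auto)
      also have "\<dots> = e / 2 + real (Suc n) * (exp (- \<kappa> * real n) * T)"
      proof -
        have "(\<Sum>k\<le>n. w n k * (e / 2) + exp (- \<kappa> * real n) * W n * T) =
              W n * (e / 2) + real (Suc n) * (exp (- \<kappa> * real n) * W n * T)"
          by (simp only: sum.distrib W_def sum_distrib_right [symmetric] sum_constant card_atMost)
        thus ?thesis using W by (simp add: add_divide_distrib)
      qed
      also have "\<dots> < e" using elim(3) unfolding T_def by linarith
      finally show ?case by (simp add: dist_real_def W_def)
    qed
  qed
qed

section \<open>Rising factorials\<close>

text \<open>Gauss's product for the Gamma function, divided by itself at another argument.\<close>
lemma pochhammer_ratio_tendsto:
  fixes a b :: real
  assumes "a > 0" "b > 0"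
  shows "(\<lambda>k. pochhammer a k / pochhammer b k / real k powr (a - b)) \<longlonglongrightarrow> Gamma b / Gamma a"
proof -
  have "(\<lambda>k. Gamma_series' b k / Gamma_series' a k) \<longlonglongrightarrow> Gamma b / Gamma a"
    using assms Gamma_real_pos[of a] by (intro tendsto_divide Gamma_series'_LIMSEQ) linarith
  moreover have "\<forall>\<^sub>F k in sequentially. Gamma_series' b k / Gamma_series' a k = 
      pochhammer a k / pochhammer b k / real k powr (a - b)"
    using eventually_gt_at_top[of 0]
  proof eventually_elim
    case (elim k)
    have "pochhammer a k > 0" "pochhammer b k > 0" using assms by (auto intro: pochhammer_pos)
    thus ?case using elim
      by (simp add: Gamma_series'_def powr_def field_simps exp_diff[symmetric] exp_add[symmetric])
  qed
  ultimately show ?thesis by (rule Lim_transform_eventually)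
qed

text \<open>
  Stirling's formula for a quotient $\Gamma(v+n)/\Gamma(v)$, where its constant $\sqrt{2\pi}$ cancels.
  One step of the rising factorial changes the error by $O(1/v^2)$, which is bounded by the
  telescoping term $1/v - 1/(v+1)$. Hence the bound is uniform in $n$.
\<close>
lemma ln_pochhammer_stirling_bound:
  "\<forall>\<^sub>F v :: real in at_top. \<forall>n. \<bar>ln (pochhammer v n) -
      (((v + real n - 1/2) * ln (v + real n) - (v + real n)) - ((v - 1/2) * ln v - v))\<bar> \<le> 1 / v"
proof -
  define G :: "real \<Rightarrow> real" where "G = (\<lambda>y. (y - 1/2) * ln y - y)"
  have "\<forall>\<^sub>F y in at_top. \<bar>ln y - (G (y + 1) - G y)\<bar> \<le> 1 / y - 1 / (y + 1)"
    unfolding G_def by real_asymp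
  then obtain Y where Y: "\<And>y. y \<ge> Y \<Longrightarrow> \<bar>ln y - (G (y + 1) - G y)\<bar> \<le> 1 / y - 1 / (y + 1)"
    by (auto simp: eventually_at_top_linorder)
  have bound: "\<bar>ln (pochhammer v n) - (G (v + real n) - G v)\<bar> \<le> 1 / v - 1 / (v + real n)"
    if "v \<ge> Y" "v > 0" for v n
  proof (induction n)
    case (Suc n)
    have "ln (pochhammer v (Suc n)) = ln (pochhammer v n) + ln (v + real n)"
      using that pochhammer_pos[of v n] by (simp add: pochhammer_Suc ln_mult)
    with Suc Y[of "v + real n"] that show ?case by (simp add: abs_le_iff add_ac)
  qed simp
  show ?thesis
    using eventually_ge_at_top[of Y] eventually_gt_at_top[of 0]
  proof eventually_elim
    case (elim v)
    show ?case
    proof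
      fix n
      have "1 / (v + real n) \<ge> 0" using elim by simp
      thus "\<bar>ln (pochhammer v n) -
      (((v + real n - 1/2) * ln (v + real n) - (v + real n)) - ((v - 1/2) * ln v - v))\<bar> \<le> 1 / v"
        using bound[of v n] elim unfolding G_def by linarith
    qed
  qed
qed

lemma pochhammer_asymp_equiv:
  fixes a c :: real
  assumes c: "c > 0"
  shows "(\<lambda>n. pochhammer (real n / c + a) n) \<sim>[sequentially]
         (\<lambda>n. (1 + c) powr (real n + real n / c + a - 1/2) * (real n / c) powr real n / exp (real n))"
proof (rule asymp_equivI')
  define G :: "real \<Rightarrow> real" where "G = (\<lambda>y. (y - 1/2) * ln y - y)"
  define F where "F = (\<lambda>n. (real n + real n / c + a - 1/2) * ln (1 + c) + real n * ln (real n / c) - real n)"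
  define v where "v = (\<lambda>n. real n / c + a)"
  have v: "filterlim v at_top sequentially" unfolding v_def using c by real_asymp
  have lim1: "(\<lambda>n. ln (pochhammer (v n) n) - (G (v n + real n) - G (v n))) \<longlonglongrightarrow> 0"
  proof (rule Lim_null_comparison)
    show "\<forall>\<^sub>F n in sequentially. norm (ln (pochhammer (v n) n) - (G (v n + real n) - G (v n))) \<le> 1 / v n"
      using eventually_compose_filterlim[OF ln_pochhammer_stirling_bound v]
      by eventually_elim (simp add: G_def)
    show "(\<lambda>n. 1 / v n) \<longlonglongrightarrow> 0" unfolding v_def using c by real_asymp
  qed
  \<comment> \<open>With \<open>y = n / c\<close>, both Stirling arguments are a large quantity plus \<open>a\<close>: \<open>v n = y + a\<close> and
      \<open>v n + n = (1 + c) * y + a\<close>. Each shift contributes \<open>a\<close> in the limit, and these cancel.\<close>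
  have lim2: "(\<lambda>n. (G (v n + real n) - G (v n)) - F n) \<longlonglongrightarrow> 0"
  proof -
    have "((\<lambda>y. ((c * y + y + a - 1/2) * ln (1 + (a / (1 + c)) / y) - a) - ((y + a - 1/2) * ln (1 + a / y) - a)) \<longlongrightarrow> 0) at_top"
      using c by (real_asymp simp: field_simps)
    moreover have "filterlim (\<lambda>n. real n / c) at_top sequentially" using c by real_asymp
    ultimately have "(\<lambda>n. ((c * (real n / c) + (real n / c) + a - 1/2) * ln (1 + (a / (1 + c)) / (real n / c)) - a) -
        (((real n / c) + a - 1/2) * ln (1 + a / (real n / c)) - a)) \<longlonglongrightarrow> 0"
      by (rule filterlim_compose)
    moreover have "\<forall>\<^sub>F n in sequentially. v n > 0" using v by (simp add: filterlim_at_top_dense)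
    hence "\<forall>\<^sub>F n in sequentially. ((c * (real n / c) + (real n / c) + a - 1/2) * ln (1 + (a / (1 + c)) / (real n / c)) - a) -
        (((real n / c) + a - 1/2) * ln (1 + a / (real n / c)) - a) = (G (v n + real n) - G (v n)) - F n"
      using eventually_gt_at_top[of 0]
    proof eventually_elim
      case (elim n)
      define y where "y = real n / c"
      have y: "y > 0" and n: "real n = c * y" using elim c by (auto simp: y_def)
      have v': "v n = y + a" by (simp add: v_def y_def)
      have p1: "1 + a / y > 0" using elim y v' by (simp add: field_simps)
      have cy: "0 < c * y" using c y by simp
      have pos2: "v n + real n > 0" using elim cy n by simp
      have p2: "1 + (a / (1 + c)) / y > 0" 
      proof -
        have "1 + (a / (1 + c)) / y = ((1 + c) * y + a) / ((1 + c) * y)"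
          using c y by (simp add: add_divide_distrib)
        also have "(1 + c) * y + a = v n + real n" by (simp add: v' n algebra_simps)
        finally have "1 + (a / (1 + c)) / y = (v n + real n) / ((1 + c) * y)" .
        thus ?thesis using pos2 c y by simp
      qed
      have e1: "ln (v n) = ln y + ln (1 + a / y)"
      proof -
        have "v n = y * (1 + a / y)" using y by (simp add: v' distrib_left)
        thus ?thesis using y p1 by (simp only: ln_mult_pos)
      qed
      have e2: "ln (v n + real n) = ln (1 + c) + ln y + ln (1 + (a / (1 + c)) / y)"
      proof -
        have "v n + real n = (1 + c) * y + a" by (simp add: v' n algebra_simps)
        also have "\<dots> = (1 + c) * y * (1 + (a / (1 + c)) / y)"
          using c y by (simp add: distrib_left)
        finally have "v n + real n = (1 + c) * y * (1 + (a / (1 + c)) / y)" .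
        thus ?thesis using c y p2 by (simp add: ln_mult)
      qed
      show ?case
        unfolding F_def G_def y_def[symmetric] e1 e2 unfolding v' n by (simp add: algebra_simps)
    qed
    ultimately show ?thesis by (rule Lim_transform_eventually)
  qed
  have "(\<lambda>n. ln (pochhammer (v n) n) - F n) \<longlonglongrightarrow> 0"
    using tendsto_add[OF lim1 lim2] by simp
  hence "(\<lambda>n. exp (ln (pochhammer (v n) n) - F n)) \<longlonglongrightarrow> exp 0" by (rule tendsto_exp)
  moreover have "\<forall>\<^sub>F n in sequentially. v n > 0" using v by (simp add: filterlim_at_top_dense)
  hence "\<forall>\<^sub>F n in sequentially. exp (ln (pochhammer (v n) n) - F n) = 
    pochhammer (real n / c + a) n / ((1 + c) powr (real n + real n / c + a - 1/2) * (real n / c) powr real n / exp (real n))"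
    using eventually_gt_at_top[of 0]
  proof eventually_elim
    case (elim n)
    thus ?case using c pochhammer_pos[of "v n" n]
      by (simp add: F_def exp_diff exp_add powr_def) (simp add: v_def)
  qed
  ultimately show "(\<lambda>n. pochhammer (real n / c + a) n / ((1 + c) powr (real n + real n / c + a - 1/2) * (real n / c) powr real n / exp (real n))) \<longlonglongrightarrow> 1"
    using Lim_transform_eventually by fastforce
qed

section \<open>The weights of the Hahn polynomial\<close>

text \<open>The terms of the terminating series ${}_2F_1(-n, n+a; 1-N; 1)$.\<close>
definition hahn_weight :: "real \<Rightarrow> real \<Rightarrow> nat \<Rightarrow> nat \<Rightarrow> real" where
  "hahn_weight a N n k = pochhammer (- real n) k * pochhammer (real n + a) k
                           / (pochhammer (1 - N) k * fact k)"

lemma hahn_weight_0 [simp]: "hahn_weight a N n 0 = 1"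
  by (simp add: hahn_weight_def)

lemma hahn_weight_Suc:
  assumes "N > real n" "k < n"
  shows "hahn_weight a N n (Suc k) * ((N - real k - 1) * (real k + 1)) =
         hahn_weight a N n k * ((real n - real k) * (real n + a + real k))"
proof -
  have "pochhammer (1 - N) k \<noteq> 0" using assms by (auto simp: pochhammer_eq_0_iff)
  moreover have "1 - N + real k \<noteq> 0" using assms by auto
  ultimately show ?thesis
    unfolding hahn_weight_def by (simp add: pochhammer_Suc divide_simps) (simp add: algebra_simps)
qed

lemma hahn_weight_pos:
  assumes "N > real n" "real n + a > 0" "k \<le> n"
  shows "hahn_weight a N n k > 0"
  using assms(3)
proof (induction k)
  case (Suc k)
  have D: "(N - real k - 1) * (real k + 1) > 0" using assms Suc.prems by (intro mult_pos_pos) auto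
  have "hahn_weight a N n k * ((real n - real k) * (real n + a + real k)) > 0"
    using assms Suc by (intro mult_pos_pos) auto
  hence "hahn_weight a N n (Suc k) * ((N - real k - 1) * (real k + 1)) > 0"
    using hahn_weight_Suc[of n N k a] assms Suc.prems by simp
  thus ?case using D zero_less_mult_pos2 by blast
qed simp

text \<open>The Chu--Vandermonde identity; the signs of the two reflected rising factorials cancel.\<close>
lemma sum_hahn_weight:
  assumes "N > real n"
  shows "(\<Sum>k\<le>n. hahn_weight a N n k) = pochhammer (N + a) n * Gamma (N - real n) / Gamma N"
proof -
  have "(\<Sum>k\<le>n. hahn_weight a N n k) =
        (\<Sum>k=0..n. pochhammer (real n + a) k * pochhammer (- real n) k / (fact k * pochhammer (1 - N) k))"
    by (intro sum.cong) (auto simp: hahn_weight_def mult_ac)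
  also have "\<dots> = pochhammer (1 - N - (real n + a)) n / pochhammer (1 - N) n"
    using assms Vandermonde_pochhammer[of n "1 - N" "real n + a"] by force
  also have "1 - N - (real n + a) = - (N + real n + a - 1)" by simp
  also have "pochhammer \<dots> n = (-1) ^ n * pochhammer (N + a) n"
    by (subst pochhammer_minus) (simp add: algebra_simps)
  also have "1 - N = - (N - 1)" by simp
  also have "pochhammer \<dots> n = (-1) ^ n * pochhammer (N - real n) n"
    by (subst pochhammer_minus) (simp add: algebra_simps)
  also have "pochhammer (N - real n) n = Gamma N / Gamma (N - real n)"
    using assms by (subst pochhammer_Gamma) (auto elim!: nonpos_Ints_cases)
  finally show ?thesis by simp
qed

lemma Hahn_eq_sum_weight:
  "Hahn n x \<alpha> \<beta> (N - 1) =
   (\<Sum>k\<le>n. hahn_weight (\<alpha> + \<beta> + 1) N n k * (pochhammer (- x) k / pochhammer (\<alpha> + 1) k))"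
  unfolding Hahn_def hahn_weight_def by (intro sum.cong) (auto simp: mult_ac add_ac)

text \<open>
  By the recurrence, consecutive weights compare like $A = (n-k)(n+a+k)$ and $D = (N-k-1)(k+1)$.
  The quadratic terms in $k$ cancel in $A - D$, which is $N(cn-k)$ up to an error of order $n$. As $A$
  and $D$ are at most $3Nn$, a gap of $N n \delta / 2$ between them is a relative gap of $\delta / 6$.
\<close>
lemma hahn_weight_ratio:
  fixes a c \<delta> :: real
  assumes c: "0 < c" "c < 1" and \<delta>: "\<delta> > 0"
  shows "\<exists>\<eta>>0. \<forall>\<^sub>F n in sequentially. \<forall>k<n.
      (real k \<le> (c - \<delta>) * real n \<longrightarrow>
         (1 + \<eta>) * hahn_weight a (real n / c) n k \<le> hahn_weight a (real n / c) n (Suc k)) \<and>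
      (real k \<ge> (c + \<delta>) * real n \<longrightarrow>
         (1 + \<eta>) * hahn_weight a (real n / c) n (Suc k) \<le> hahn_weight a (real n / c) n k)"
proof -
  define M where "M = \<bar>a\<bar> + 1 / c + 3"
  have "\<forall>\<^sub>F n in sequentially. \<delta> * (real n / c) \<ge> 2 * M" using c \<delta> by real_asymp
  moreover have "\<forall>\<^sub>F n in sequentially. real n > \<bar>a\<bar> + 1" by real_asymp
  ultimately have "\<forall>\<^sub>F n in sequentially. \<forall>k<n.
      (real k \<le> (c - \<delta>) * real n \<longrightarrow>
         (1 + \<delta> / 6) * hahn_weight a (real n / c) n k \<le> hahn_weight a (real n / c) n (Suc k)) \<and>
      (real k \<ge> (c + \<delta>) * real n \<longrightarrow>
         (1 + \<delta> / 6) * hahn_weight a (real n / c) n (Suc k) \<le> hahn_weight a (real n / c) n k)"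
  proof eventually_elim
    case (elim n)
    define N where "N = real n / c"
    have n: "real n > 0" using elim by linarith
    have N: "N > real n" using c n by (simp add: N_def field_simps)
    have cN: "real n = c * N" using c by (simp add: N_def)
    have na: "real n + a > 0" using elim by linarith
    show ?case unfolding N_def[symmetric]
    proof (intro allI impI conjI)
      fix k assume k: "k < n"
      define A where "A = (real n - real k) * (real n + a + real k)"
      define D where "D = (N - real k - 1) * (real k + 1)"
      have step: "hahn_weight a N n (Suc k) * D = hahn_weight a N n k * A"
        unfolding A_def D_def using hahn_weight_Suc[OF N k] .
      have w: "hahn_weight a N n k > 0" "hahn_weight a N n (Suc k) > 0"
        using hahn_weight_pos[OF N na] k by auto
      have k1: "real k + 1 \<le> real n" using k by linarith
      have A: "A > 0" unfolding A_def using k na by (intro mult_pos_pos) auto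
      have D: "D > 0" unfolding D_def using N k1 by (intro mult_pos_pos) auto
      have Dle: "D \<le> N * real n" unfolding D_def using N k1 n by (intro mult_mono) auto
      have Ale: "A \<le> 3 * (N * real n)"
      proof -
        have "A \<le> real n * (3 * real n)" unfolding A_def
          using k1 na elim by (intro mult_mono) auto
        also have "\<dots> \<le> real n * (3 * N)" using N n by (intro mult_left_mono) auto
        finally show ?thesis by (simp add: mult_ac)
      qed
      have diff: "A - D = N * (c * real n - real k) + (a * (real n - real k) - N + 2 * real k + 1)"
        unfolding A_def D_def using cN by (simp add: algebra_simps)
      have rest: "\<bar>a * (real n - real k) - N + 2 * real k + 1\<bar> \<le> M * real n"
      proof -
        have "\<bar>a * (real n - real k)\<bar> \<le> \<bar>a\<bar> * real n"
          unfolding abs_mult using k by (intro mult_left_mono) auto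
        moreover have "N = 1 / c * real n" by (simp add: N_def)
        moreover have "M * real n = \<bar>a\<bar> * real n + 1 / c * real n + 3 * real n"
          by (simp add: M_def algebra_simps)
        ultimately show ?thesis using k1 N n by linarith
      qed
      have half: "M * real n \<le> N * real n * \<delta> / 2"
      proof -
        have "2 * M * real n \<le> \<delta> * N * real n" using elim(1) n unfolding N_def by (intro mult_right_mono) auto
        thus ?thesis by (simp add: algebra_simps)
      qed
      {
        assume "real k \<le> (c - \<delta>) * real n"
        hence "N * (\<delta> * real n) \<le> N * (c * real n - real k)"
          using N n by (intro mult_left_mono) (auto simp: algebra_simps)
        hence "A - D \<ge> N * real n * \<delta> / 2" using diff rest half by (simp add: algebra_simps)
        moreover have "D * (\<delta> / 6) \<le> N * real n * (\<delta> / 6)" using Dle \<delta> by (intro mult_right_mono) auto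
        moreover have "N * real n * \<delta> \<ge> 0" using N n \<delta> by simp
        ultimately have "(1 + \<delta> / 6) * D \<le> A" by (simp add: algebra_simps)
        hence "hahn_weight a N n k * ((1 + \<delta> / 6) * D) \<le> hahn_weight a N n (Suc k) * D"
          using w by (simp add: step)
        thus "(1 + \<delta> / 6) * hahn_weight a N n k \<le> hahn_weight a N n (Suc k)"
          using D by (simp add: mult_ac)
      next
        assume "real k \<ge> (c + \<delta>) * real n"
        hence "N * (c * real n - real k) \<le> N * (- \<delta> * real n)"
          using N n by (intro mult_left_mono) (auto simp: algebra_simps)
        hence "D - A \<ge> N * real n * \<delta> / 2" using diff rest half by (simp add: algebra_simps)
        moreover have "A * (\<delta> / 6) \<le> 3 * (N * real n) * (\<delta> / 6)" using Ale \<delta> by (intro mult_right_mono) auto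
        ultimately have "(1 + \<delta> / 6) * A \<le> D" by (simp add: algebra_simps)
        hence "hahn_weight a N n (Suc k) * ((1 + \<delta> / 6) * A) \<le> hahn_weight a N n k * A"
          using w by (simp flip: step)
        thus "(1 + \<delta> / 6) * hahn_weight a N n (Suc k) \<le> hahn_weight a N n k"
          using A by (simp add: mult_ac)
      }
    qed
  qed
  thus ?thesis using \<delta> by (intro exI[of _ "\<delta> / 6"]) auto
qed

section \<open>The asymptotics of the Hahn polynomial\<close>

lemma Hahn_asymp_equiv:
  fixes \<alpha> \<beta> c x :: real
  assumes \<alpha>: "\<alpha> > -1" and \<beta>: "\<beta> > -1" and c: "0 < c" "c < 1" and x: "x < 0"
  shows "(\<lambda>n. Hahn n x \<alpha> \<beta> (real n / c - 1)) \<sim>[sequentially]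
         (\<lambda>n. Gamma (\<alpha> + 1) / Gamma (- x) * (c * real n) powr (- x - \<alpha> - 1) *
            (pochhammer (real n / c + (\<alpha> + \<beta> + 1)) n * Gamma (real n / c - real n) / Gamma (real n / c)))"
proof -
  define a where "a = \<alpha> + \<beta> + 1"
  define w where "w = (\<lambda>n. hahn_weight a (real n / c) n)"
  have N: "real n / c > real n" if "n > 0" for n :: nat using that c by (simp add: field_simps)
  have pos: "w n k > 0" if "k \<le> n" for n k
  proof (cases "n = 0")
    case False
    thus ?thesis using that N[of n] \<alpha> \<beta> unfolding w_def by (intro hahn_weight_pos) (auto simp: a_def)
  qed (use that in \<open>simp add: w_def\<close>)
  have sum_pos: "(\<Sum>k\<le>n. w n k) > 0" for n using pos by (intro sum_pos) auto
  have main: "(\<lambda>n. \<Sum>k\<le>n. w n k * (pochhammer (- x) k / pochhammer (\<alpha> + 1) k)) \<sim>[sequentially]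
        (\<lambda>n. Gamma (\<alpha> + 1) / Gamma (- x) * (c * real n) powr (- x - (\<alpha> + 1)) * (\<Sum>k\<le>n. w n k))"
  proof (rule weighted_sum_asymp_equiv)
    show "w n k \<ge> 0" if "k \<le> n" for n k using pos[OF that] by simp
    show "\<forall>\<^sub>F n in sequentially. (\<Sum>k\<le>n. w n k) > 0" using sum_pos by simp
    show "\<exists>\<kappa>>0. \<forall>\<^sub>F n in sequentially. \<forall>k\<le>n.
          \<bar>real k - c * real n\<bar> \<ge> \<delta> * real n \<longrightarrow> w n k \<le> exp (- \<kappa> * real n) * (\<Sum>i\<le>n. w n i)"
      if "\<delta> > 0" for \<delta>
      using that c pos hahn_weight_ratio[OF c, of _ a]
      by (intro exp_tail_of_local_ratio) (auto simp: w_def less_imp_le)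
    show "(\<lambda>k. pochhammer (- x) k / pochhammer (\<alpha> + 1) k / real k powr (- x - (\<alpha> + 1)))
            \<longlonglongrightarrow> Gamma (\<alpha> + 1) / Gamma (- x)"
      using \<alpha> x by (intro pochhammer_ratio_tendsto) auto
    show "Gamma (\<alpha> + 1) / Gamma (- x) > 0" using \<alpha> x by (intro divide_pos_pos Gamma_real_pos) auto
  qed (use c in auto)
  have total: "\<forall>\<^sub>F n in sequentially. (\<Sum>k\<le>n. w n k) =
      pochhammer (real n / c + a) n * Gamma (real n / c - real n) / Gamma (real n / c)"
    using eventually_gt_at_top[of 0]
  proof eventually_elim
    case (elim n)
    thus ?case unfolding w_def using N by (intro sum_hahn_weight) auto
  qed
  show ?thesis
    unfolding Hahn_eq_sum_weight a_def[symmetric] diff_diff_eq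
  proof (rule asymp_equiv_transfer[OF main])
    show "\<forall>\<^sub>F n in sequentially.
        Gamma (\<alpha> + 1) / Gamma (- x) * (c * real n) powr (- x - (\<alpha> + 1)) * (\<Sum>k\<le>n. w n k) =
        Gamma (\<alpha> + 1) / Gamma (- x) * (c * real n) powr (- x - (\<alpha> + 1)) *
          (pochhammer (real n / c + a) n * Gamma (real n / c - real n) / Gamma (real n / c))"
      using total by eventually_elim simp
  qed (simp add: w_def)
qed

text \<open>
  The hypothesis $n_j / N_j = c$ forces $N_j = n_j / c$ and $n_j > 0$, so the claim is the limit along
  all natural numbers $n$, composed with the sequence $n_j$.
\<close>
theorem mainTheorem2:
  fixes \<alpha> \<beta> c x :: real and n :: "nat \<Rightarrow> nat" and N :: "nat \<Rightarrow> real"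
  assumes "\<alpha> > -1" and "\<beta> > -1"
    and "0 < c" and "c < 1"
    and "x < -1/2"
    and "filterlim n at_top sequentially"
    and "\<And>j. real (n j) / N j = c"
  shows "(\<lambda>j. Hahn (n j) x \<alpha> \<beta> (N j - 1)) \<sim>[sequentially]
         (\<lambda>j. Gamma (\<alpha> + 1) * Gamma (N j - real (n j))
               / (Gamma (N j) * Gamma (- x) * exp (real (n j)) * real (n j) powr (2 * x + 2 * \<alpha> + 2))
               * (1 + c) powr (real (n j) + N j + \<alpha> + \<beta> + 1/2)
               * N j powr (x + real (n j) + \<alpha> + 1))"
proof -
  have N: "N j = real (n j) / c" and n0: "n j > 0" for j
    using assms(3) assms(7)[of j] by (auto simp: field_simps intro: Nat.gr0I)
  have "(\<lambda>m. Hahn m x \<alpha> \<beta> (real m / c - 1)) \<sim>[sequentially]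
         (\<lambda>m. Gamma (\<alpha> + 1) / Gamma (- x) * (c * real m) powr (- x - \<alpha> - 1) *
            (((1 + c) powr (real m + real m / c + (\<alpha> + \<beta> + 1) - 1/2) * (real m / c) powr real m / exp (real m))
              * Gamma (real m / c - real m) / Gamma (real m / c)))"
    using assms(1-5)
    by (intro asymp_equiv_trans[OF Hahn_asymp_equiv] asymp_equiv_intros pochhammer_asymp_equiv) auto
  from asymp_equiv_compose'[OF this assms(6)]
  show ?thesis
  proof (rule asymp_equiv_transfer)
    show "\<forall>\<^sub>F j in sequentially. Hahn (n j) x \<alpha> \<beta> (real (n j) / c - 1) = Hahn (n j) x \<alpha> \<beta> (N j - 1)"
      by (simp add: N)
    show "\<forall>\<^sub>F j in sequentially. 
         Gamma (\<alpha> + 1) / Gamma (- x) * (c * real (n j)) powr (- x - \<alpha> - 1) *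
            (((1 + c) powr (real (n j) + real (n j) / c + (\<alpha> + \<beta> + 1) - 1/2) * (real (n j) / c) powr real (n j) / exp (real (n j)))
              * Gamma (real (n j) / c - real (n j)) / Gamma (real (n j) / c)) =
         Gamma (\<alpha> + 1) * Gamma (N j - real (n j))
               / (Gamma (N j) * Gamma (- x) * exp (real (n j)) * real (n j) powr (2 * x + 2 * \<alpha> + 2))
               * (1 + c) powr (real (n j) + N j + \<alpha> + \<beta> + 1/2)
               * N j powr (x + real (n j) + \<alpha> + 1)"
    proof (intro always_eventually allI)
      fix j
      have regroup: "A / A' * Y * ((U * M / e) * H / H') = A * H / (H' * A' * e * E) * U * Z"
        if "Y * M = Z / E" for A A' Y U M e H H' E Z :: real
      proof -
        have "A / A' * Y * ((U * M / e) * H / H') = (Y * M) * (A * U * H / (A' * e * H'))"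
          by (simp add: mult_ac)
        also have "\<dots> = (Z / E) * (A * U * H / (A' * e * H'))" by (simp only: that)
        also have "\<dots> = A * H / (H' * A' * e * E) * U * Z" by (simp add: mult_ac)
        finally show ?thesis .
      qed
      define p where "p = - x - \<alpha> - 1"
      have pos: "real (n j) > 0" "N j > 0" using n0[of j] assms(3) by (simp_all add: N)
      have nN: "c * real (n j) = real (n j) * real (n j) / N j" using pos assms(3) by (simp add: N)
      have "(c * real (n j)) powr p = real (n j) powr p * real (n j) powr p / N j powr p"
        using pos by (simp add: nN powr_divide powr_mult)
      also have "\<dots> = real (n j) powr (p + p) * N j powr (- p)"
        by (simp only: powr_add powr_minus divide_inverse)
      also have "p + p = - (2 * x + 2 * \<alpha> + 2)" by (simp add: p_def)
      also have "- p = x + \<alpha> + 1" by (simp add: p_def)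
      also have "real (n j) powr (- (2 * x + 2 * \<alpha> + 2)) * N j powr (x + \<alpha> + 1) =
          N j powr (x + \<alpha> + 1) / real (n j) powr (2 * x + 2 * \<alpha> + 2)"
        by (simp only: powr_minus divide_inverse mult.commute)
      finally have "(c * real (n j)) powr p * N j powr real (n j) =
          N j powr (x + \<alpha> + 1) * N j powr real (n j) / real (n j) powr (2 * x + 2 * \<alpha> + 2)"
        by (simp only: times_divide_eq_left)
      also have "N j powr (x + \<alpha> + 1) * N j powr real (n j) = N j powr (x + real (n j) + \<alpha> + 1)"
        by (simp add: add_ac flip: powr_add)
      finally have "(c * real (n j)) powr p * N j powr real (n j) =
          N j powr (x + real (n j) + \<alpha> + 1) / real (n j) powr (2 * x + 2 * \<alpha> + 2)" .
      note regroup = regroup[OF this]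
      have "real (n j) + N j + (\<alpha> + \<beta> + 1) - 1/2 = real (n j) + N j + \<alpha> + \<beta> + 1/2" by simp
      thus "Gamma (\<alpha> + 1) / Gamma (- x) * (c * real (n j)) powr (- x - \<alpha> - 1) *
            (((1 + c) powr (real (n j) + real (n j) / c + (\<alpha> + \<beta> + 1) - 1/2) * (real (n j) / c) powr real (n j) / exp (real (n j)))
              * Gamma (real (n j) / c - real (n j)) / Gamma (real (n j) / c)) =
         Gamma (\<alpha> + 1) * Gamma (N j - real (n j))
               / (Gamma (N j) * Gamma (- x) * exp (real (n j)) * real (n j) powr (2 * x + 2 * \<alpha> + 2))
               * (1 + c) powr (real (n j) + N j + \<alpha> + \<beta> + 1/2)
               * N j powr (x + real (n j) + \<alpha> + 1)"
        unfolding N[symmetric] p_def[symmetric] by (simp only: regroup)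
    qed
  qed
qed

end
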